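(* Let $n>1$ be an integer and let $D_n$ be the set of divisors $d$ of $n$ with $1\le d<n$. Then $\mathrm{maxspread}(n)=n$. Moreover, for $D\subseteq D_n$ such that the integral circulant graph $\mathrm{ICG}_n(D)$ is connected, the spread $s(\mathrm{ICG}_n(D))$ attains $\mathrm{maxspread}(n)=n$ if and only if $\gcd(\{d : d\in D_n\setminus D\})>1$.
   Context: For $D\subseteq D_n$, the integral circulant graph $\mathrm{ICG}_n(D)$ has vertex set $\mathbb{Z}_n=\{0,1,\ldots,n-1\}$, with $a$ and $b$ adjacent if and only if $\gcd(a-b,n)\in D$. The eigenvalues of its adjacency matrix are indexed as $$\lambda_j=\lambda_j(n,D)=\sum_{d\in D} c\left(j,\tfrac{n}{d}\right),\qquad 0\le j\le n-1,$$ where, for a positive integer $m$ and an integer $j\ge 0$, $$c(j,m)=\mu(t_{m,j})\frac{\varphi(m)}{\varphi(t_{m,j})},\qquad t_{m,j}=\frac{m}{\gcd(m,j)},$$ with $\mu$ the Möbius function, $\varphi$ Euler's totient function, and $\gcd(m,0)=m$. In particular $\lambda_0=\sum_{d\in D}\varphi(n/d)$ is the degree of the graph. The spread is $s(\mathrm{ICG}_n(D))=\max\{\lambda_0-\lambda_j : 1\le j\le n-1\}$, and $\mathrm{maxspread}(n)=\max\{s(\mathrm{ICG}_n(D)) : D\subseteq D_n\}$.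
   Formalization: When D = D_n the set D_n \ D is empty and its gcd is 0 by the usual convention, though the complete graph has spread n; the condition gcd > 1 is therefore taken to hold when D_n \ D is empty. *)

theory Defs
  imports
    Complex_Main
    "HOL-Computational_Algebra.Squarefree"
    "HOL-Number_Theory.Totient"
    "Graph_Theory.Graph_Theory"
begin

definition proper_divisors :: "nat \<Rightarrow> nat set" where
  "proper_divisors n = {d. d dvd n \<and> 1 \<le> d \<and> d < n}"

definition ICG :: "nat \<Rightarrow> nat set \<Rightarrow> int pair_pre_digraph" where
  "ICG n D = \<lparr> pverts = {0..<int n},
     parcs = {(a, b). a \<in> {0..<int n} \<and> b \<in> {0..<int n} \<and> nat (gcd (a - b) (int n)) \<in> D} \<rparr>"

lemma pair_graph_ICG:
  assumes "D \<subseteq> proper_divisors n"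
  shows "pair_graph (ICG n D)"
proof
  show "finite (pverts (ICG n D))"
    by (simp add: ICG_def)
  have "parcs (ICG n D) \<subseteq> {0..<int n} \<times> {0..<int n}"
    by (auto simp: ICG_def)
  then show "finite (parcs (ICG n D))"
    by (rule finite_subset) simp
  show "fst e \<in> pverts (ICG n D)" "snd e \<in> pverts (ICG n D)" if "e \<in> parcs (ICG n D)" for e
    using that by (auto simp: ICG_def)
  show "fst e \<noteq> snd e" if "e \<in> parcs (ICG n D)" for e
    using that assms by (auto simp: ICG_def proper_divisors_def)
  have "gcd (a - b) (int n) = gcd (b - a) (int n)" for a b
    by (metis gcd_neg1 minus_diff_eq)
  then show "symmetric (with_proj (ICG n D))"
    by (auto simp: symmetric_def sym_def ICG_def)
qed

definition moebius_mu :: "nat \<Rightarrow> int" where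
  "moebius_mu m = (if squarefree m then (-1) ^ card (prime_factors m) else 0)"

text \<open>
  For \<open>m > 0\<close> this is the Ramanujan sum \<open>c(j, m)\<close>. The quotient \<open>m div gcd m j\<close> is exact,
  and \<open>gcd m 0 = m\<close>, so that \<open>ramanujan_sum 0 m = totient m\<close>.
\<close>
definition ramanujan_sum :: "nat \<Rightarrow> nat \<Rightarrow> real" where
  "ramanujan_sum j m =
     (let t = m div gcd m j
      in real_of_int (moebius_mu t) * (real (totient m) / real (totient t)))"

definition ICG_eigenvalue :: "nat \<Rightarrow> nat set \<Rightarrow> nat \<Rightarrow> real" where
  "ICG_eigenvalue n D j = (\<Sum>d\<in>D. ramanujan_sum j (n div d))"

definition ICG_spread :: "nat \<Rightarrow> nat set \<Rightarrow> real" where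
  "ICG_spread n D = Max {ICG_eigenvalue n D 0 - ICG_eigenvalue n D j | j. 1 \<le> j \<and> j \<le> n - 1}"

definition maxspread :: "nat \<Rightarrow> real" where
  "maxspread n = Max {ICG_spread n D | D. D \<subseteq> proper_divisors n}"

text \<open>
  The condition \<open>gcd A > 1\<close> for a finite set \<open>A\<close> of positive integers, in the sense that the
  members of \<open>A\<close> have a common divisor greater than one. The empty set satisfies this vacuously,
  but \<^term>\<open>Gcd {} = (0 :: nat)\<close>, so it is listed separately. It arises when \<open>D\<close> consists of
  all proper divisors of \<open>n\<close>: then the graph is complete, with eigenvalues \<open>n - 1\<close> and \<open>-1\<close>,
  and its spread is \<open>n\<close>.
\<close>
definition gcd_gt_one :: "nat set \<Rightarrow> bool" where
  "gcd_gt_one A \<longleftrightarrow> A = {} \<or> Gcd A > 1"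

end

theory Submission
  imports Defs
begin

text \<open>
  Write \<open>E = proper_divisors n - D\<close> for the divisors left out of \<open>D\<close>, and \<open>c\<close> for
  \<^const>\<open>ramanujan_sum\<close>. The sum of \<open>c(j, m)\<close> over all divisors \<open>m\<close> of \<open>n\<close> is \<open>n\<close> if
  \<open>n\<close> divides \<open>j\<close> and \<open>0\<close> otherwise (lemma \<open>ramanujan_sum_divisor_sum\<close>): it is a sum of all
  \<open>n\<close>-th roots of unity, each raised to the power \<open>j\<close>. The divisor \<open>m = 1\<close> contributes \<open>1\<close>, so
  passing from \<open>D\<close> to its complement \<open>E\<close> turns an eigenvalue \<open>\<lambda>\<close> into \<open>- 1 - \<lambda>\<close>, or into
  \<open>n - 1 - \<lambda>\<close> for \<open>j = 0\<close>. Hence for \<open>1 \<le> j < n\<close> the difference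
  \<open>\<lambda>\<^sub>0(D) - \<lambda>\<^sub>j(D)\<close> equals \<open>n - (\<lambda>\<^sub>0(E) - \<lambda>\<^sub>j(E))\<close>.

  Each term of \<open>\<lambda>\<^sub>0(E) - \<lambda>\<^sub>j(E)\<close> is a difference \<open>\<phi>(m) - c(j, m)\<close>, which is nonnegative and
  vanishes only when \<open>m\<close> divides \<open>j\<close> (lemma \<open>ramanujan_sum_eq_totient_iff\<close>). So the spread is at
  most \<open>n\<close>, and it equals \<open>n\<close> if and only if some \<open>j\<close> with \<open>1 \<le> j < n\<close> is a multiple of \<open>n / d\<close>
  for all \<open>d\<close> in \<open>E\<close>. That means \<open>n\<close> divides \<open>j * Gcd E\<close>. This is impossible if \<open>Gcd E = 1\<close>,
  and \<open>j = n / Gcd E\<close> satisfies it if \<open>Gcd E > 1\<close>; an empty \<open>E\<close> imposes no condition on \<open>j\<close>.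
  Taking all proper divisors for \<open>D\<close> makes \<open>E\<close> empty and shows that the bound \<open>n\<close> is attained.
\<close>

section \<open>Divisor sums of multiplicative functions\<close>

text \<open>
  A divisor of \<open>a * b\<close> splits uniquely into a divisor of \<open>a\<close> and a divisor of \<open>b\<close>, so the sum
  on the left is the expanded product on the right.
\<close>
lemma divisor_sum_mult_coprime:
  fixes f :: "nat \<Rightarrow> 'a :: comm_semiring_1"
  assumes mult: "\<And>x y. coprime x y \<Longrightarrow> x > 0 \<Longrightarrow> y > 0 \<Longrightarrow> f (x * y) = f x * f y"
    and ab: "coprime a b" "a > 0" "b > 0"
  shows "(\<Sum>d | d dvd a * b. f d) = (\<Sum>d | d dvd a. f d) * (\<Sum>e | e dvd b. f e)"
proof -
  let ?P = "{d. d dvd a} \<times> {e. e dvd b}"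
  have cop: "coprime d e" if "d dvd a" "e dvd b" for d e
    using that ab(1) by (rule coprime_divisors)
  have inj: "inj_on (\<lambda>(d, e). d * e) ?P"
  proof (rule inj_onI, clarify)
    fix d e d' e'
    assume dvd: "d dvd a" "e dvd b" "d' dvd a" "e' dvd b" and eq: "d * e = d' * e'"
    have "d dvd d'"
      using cop[OF dvd(1,4)] eq by (metis coprime_dvd_mult_left_iff dvd_triv_left)
    moreover have "d' dvd d"
      using cop[OF dvd(3,2)] eq by (metis coprime_dvd_mult_left_iff dvd_triv_left)
    ultimately have "d = d'"
      by (rule dvd_antisym)
    moreover have "d > 0"
      using dvd(1) ab(2) by (auto intro: Nat.gr0I)
    ultimately show "d = d' \<and> e = e'"
      using eq by simp
  qed
  have img: "(\<lambda>(d, e). d * e) ` ?P = {d. d dvd a * b}"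
  proof (intro equalityI subsetI)
    fix x assume "x \<in> {d. d dvd a * b}"
    then obtain d e where "x = d * e" "d dvd a" "e dvd b"
      using division_decomp[of x a b] by auto
    then show "x \<in> (\<lambda>(d, e). d * e) ` ?P"
      by force
  qed (auto intro: mult_dvd_mono)
  have "(\<Sum>d | d dvd a * b. f d) = (\<Sum>(d, e)\<in>?P. f (d * e))"
    unfolding img[symmetric] by (subst sum.reindex[OF inj]) (simp add: case_prod_unfold)
  also have "\<dots> = (\<Sum>(d, e)\<in>?P. f d * f e)"
    using ab by (intro sum.cong) (auto intro!: mult cop Nat.gr0I)
  finally show ?thesis
    by (simp add: sum_product sum.cartesian_product)
qed

section \<open>Ramanujan sums\<close>

lemma moebius_mu_mult_coprime:
  assumes "coprime a b" "a > 0" "b > 0"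
  shows "moebius_mu (a * b) = moebius_mu a * moebius_mu b"
proof (cases "squarefree a \<and> squarefree b")
  case True
  have "prime_factors a \<inter> prime_factors b = {}"
    using assms(1) by (meson coprime_common_divisor disjoint_iff in_prime_factors_imp_dvd
        in_prime_factors_imp_prime not_prime_unit)
  with True assms show ?thesis
    by (simp add: moebius_mu_def squarefree_mult_coprime prime_factors_product
        card_Un_disjoint power_add)
next
  case False
  then show ?thesis
    by (auto simp: moebius_mu_def dest: squarefree_multD)
qed

lemma ramanujan_sum_mult_coprime:
  assumes "coprime a b" "a > 0" "b > 0"
  shows "ramanujan_sum j (a * b) = ramanujan_sum j a * ramanujan_sum j b"
proof -
  define s t where "s = a div gcd a j" and "t = b div gcd b j"
  have a: "a = s * gcd a j" and b: "b = t * gcd b j"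
    by (simp_all add: s_def t_def)
  have pos: "s > 0" "t > 0"
    using a b assms(2,3) by (auto intro: Nat.gr0I)
  have cop: "coprime s t"
    using a b assms(1) by (metis coprime_mult_left_iff coprime_mult_right_iff)
  have "coprime (gcd a j) (gcd b j)"
    using assms(1) by (rule coprime_divisors[rotated 2]) simp_all
  have gcd: "gcd (a * b) j = gcd a j * gcd b j"
  proof (intro dvd_antisym)
    show "gcd a j * gcd b j dvd gcd (a * b) j"
      using \<open>coprime (gcd a j) (gcd b j)\<close> by (auto intro: divides_mult mult_dvd_mono)
    show "gcd (a * b) j dvd gcd a j * gcd b j"
    proof -
      obtain x y where xy: "gcd (a * b) j = x * y" "x dvd a" "y dvd b"
        using division_decomp[of "gcd (a * b) j" a b] by auto
      moreover have "x * y dvd j"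
        by (metis xy(1) gcd_dvd2)
      ultimately show ?thesis
        by (metis dvd_mult_left dvd_mult_right gcd_greatest mult_dvd_mono)
    qed
  qed
  have "a * b div gcd (a * b) j = s * t"
    unfolding gcd s_def t_def by (simp add: div_mult_div_if_dvd)
  then show ?thesis
    using cop pos assms
    by (simp add: ramanujan_sum_def Let_def moebius_mu_mult_coprime totient_mult_coprime
        flip: s_def t_def)
qed

lemma ramanujan_sum_eq_totient:
  assumes "m dvd j" "m > 0"
  shows "ramanujan_sum j m = real (totient m)"
proof -
  have "gcd m j = m"
    using assms by (simp add: gcd_nat.absorb1)
  then show ?thesis
    using assms by (simp add: ramanujan_sum_def moebius_mu_def)
qed

text \<open>
  A Ramanujan sum adds up \<open>\<phi>(m)\<close> roots of unity, so it reaches \<open>\<phi>(m)\<close> only if all of them are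
  \<open>1\<close>. In the closed form this reads: \<open>\<mu>(t) / \<phi>(t) \<le> 1\<close>, and equality forces \<open>\<phi>(t) = 1\<close>, that
  is \<open>t \<le> 2\<close>, where \<open>t = 2\<close> is excluded by the sign \<open>\<mu>(2) = - 1\<close>.
\<close>
lemma ramanujan_sum_le_totient:
  assumes "m > 0"
  shows "ramanujan_sum j m \<le> real (totient m)"
    and ramanujan_sum_eq_totient_iff: "ramanujan_sum j m = real (totient m) \<longleftrightarrow> m dvd j"
proof -
  define t where "t = m div gcd m j"
  have m: "m = t * gcd m j"
    by (simp add: t_def)
  have t: "t > 0"
    using m assms by (auto intro: Nat.gr0I)
  have c: "ramanujan_sum j m = real (totient m) * (moebius_mu t / totient t)"
    by (simp add: ramanujan_sum_def t_def Let_def)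
  have pos: "real (totient m) > 0" "real (totient t) > 0"
    using assms t by simp_all
  have mu: "moebius_mu t \<le> 1"
    by (cases "even (card (prime_factors t))") (auto simp: moebius_mu_def)
  have less: "moebius_mu t < int (totient t)" if "t \<noteq> 1"
  proof (cases "t = 2")
    case True
    have "prime_factors (2 :: nat) = {2}"
      by (simp add: prime_prime_factors)
    with True show ?thesis
      by (simp add: moebius_mu_def squarefree_prime)
  next
    case False
    with that t have "totient t > 1"
      by (intro totient_gt_1) auto
    with mu show ?thesis
      by linarith
  qed
  have le: "moebius_mu t \<le> int (totient t)"
    using less mu t by (cases "t = 1") force+
  then have "real_of_int (moebius_mu t) / real (totient t) \<le> 1"
    using pos by (simp add: divide_le_eq)
  then have "ramanujan_sum j m \<le> real (totient m) * 1"
    unfolding c by (intro mult_left_mono) simp_all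
  then show "ramanujan_sum j m \<le> real (totient m)"
    by simp
  show "ramanujan_sum j m = real (totient m) \<longleftrightarrow> m dvd j"
  proof
    assume "ramanujan_sum j m = real (totient m)"
    then have "real_of_int (moebius_mu t) / real (totient t) = 1"
      unfolding c using pos(1) by (metis less_irrefl mult_cancel_left2)
    then have "real_of_int (moebius_mu t) = real (totient t)"
      by (simp add: divide_eq_1_iff)
    then have "moebius_mu t = int (totient t)"
      by linarith
    with less have "t = 1"
      by auto
    then show "m dvd j"
      using m by (metis gcd_dvd2 mult_1)
  qed (simp add: ramanujan_sum_eq_totient assms)
qed

text \<open>
  If \<open>gcd(p\<^sup>k\<^sup>+\<^sup>1, j) = p\<^sup>i\<close>, the argument of the Moebius function is \<open>p\<close> to the power
  \<open>k + 1 - i\<close>, which is \<open>1\<close>, \<open>p\<close> or not squarefree. The totients are written out as differences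
  of powers of \<open>p\<close> so that the sum over all powers of \<open>p\<close> telescopes.
\<close>
lemma ramanujan_sum_prime_power_Suc:
  assumes p: "prime p"
  shows "ramanujan_sum j (p ^ Suc k) =
    (if p ^ Suc k dvd j then real (p ^ Suc k) - real (p ^ k)
     else if p ^ k dvd j then - real (p ^ k) else 0)"
proof -
  have p1: "p > 1"
    using p by (rule prime_gt_1_nat)
  have tot: "real (totient (p ^ Suc i)) = real (p ^ i) * (real p - 1)" for i
    using p1 totient_prime_power_Suc[OF p, of i] by (simp add: of_nat_diff del: power_Suc)
  obtain i where i: "gcd (p ^ Suc k) j = p ^ i" "i \<le> Suc k"
    using divides_primepow_nat[OF p, of "gcd (p ^ Suc k) j" "Suc k"] by auto
  have dvd: "p ^ l dvd j \<longleftrightarrow> l \<le> i" if "l \<le> Suc k" for l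
  proof -
    have "p ^ l dvd j \<longleftrightarrow> p ^ l dvd gcd (p ^ Suc k) j"
      using that by (simp add: le_imp_power_dvd del: power_Suc)
    then show ?thesis
      unfolding i(1) using p1 power_dvd_imp_le le_imp_power_dvd by blast
  qed
  have t: "p ^ Suc k div gcd (p ^ Suc k) j = p ^ (Suc k - i)"
    using p1 i by (simp add: power_diff del: power_Suc)
  consider "i = Suc k" | "i = k" | "i < k"
    using i(2) by linarith
  then show ?thesis
  proof cases
    case 1
    then show ?thesis
      using dvd[of "Suc k"] p1 tot[of k]
      by (simp add: ramanujan_sum_eq_totient algebra_simps)
  next
    case 2
    have "moebius_mu p = - 1"
      using p by (simp add: moebius_mu_def squarefree_prime prime_prime_factors)
    moreover have "real (totient p) = real p - 1"
      using tot[of 0] by simp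
    ultimately have "ramanujan_sum j (p ^ Suc k) = - real (p ^ k)"
      using 2 p1 tot[of k] t by (simp add: ramanujan_sum_def del: power_Suc)
    with 2 dvd[of k] dvd[of "Suc k"] show ?thesis
      by simp
  next
    case 3
    have "\<not> squarefree (p ^ (Suc k - i))"
      using 3 p1 by (auto simp: squarefree_power_iff simp del: power_Suc)
    then have "ramanujan_sum j (p ^ Suc k) = 0"
      by (simp add: ramanujan_sum_def t moebius_mu_def del: power_Suc)
    with 3 dvd[of k] dvd[of "Suc k"] show ?thesis
      by simp
  qed
qed

lemma ramanujan_sum_divisor_sum_prime_power:
  assumes p: "prime p"
  shows "(\<Sum>m | m dvd p ^ k. ramanujan_sum j m) = (if p ^ k dvd j then real (p ^ k) else 0)"
proof (induction k)
  case 0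
  then show ?case
    by (simp add: ramanujan_sum_eq_totient)
next
  case (Suc k)
  have p1: "p > 1"
    using p by (rule prime_gt_1_nat)
  have "{m. m dvd p ^ Suc k} = insert (p ^ Suc k) {m. m dvd p ^ k}"
    by (auto simp: divides_primepow_nat[OF p] le_Suc_eq simp del: power_Suc)
  moreover have "\<not> p ^ Suc k dvd p ^ k"
    using p1 by (simp add: dvd_power_iff_le del: power_Suc)
  ultimately have "(\<Sum>m | m dvd p ^ Suc k. ramanujan_sum j m) =
      ramanujan_sum j (p ^ Suc k) + (\<Sum>m | m dvd p ^ k. ramanujan_sum j m)"
    using p1 by (simp del: power_Suc)
  moreover have "p ^ k dvd j" if "p ^ Suc k dvd j"
    using that by (rule power_le_dvd) simp
  ultimately show ?case
    unfolding ramanujan_sum_prime_power_Suc[OF p] Suc.IH by auto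
qed

text \<open>
  This is the orthogonality relation for the \<open>n\<close>-th roots of unity, grouped by their order \<open>m\<close>.
  For the closed form of the Ramanujan sum, which is multiplicative in \<open>m\<close>, it reduces to prime
  powers, where the sum telescopes.
\<close>
lemma ramanujan_sum_divisor_sum:
  assumes "n > 0"
  shows "(\<Sum>m | m dvd n. ramanujan_sum j m) = (if n dvd j then real n else 0)"
  using assms
proof (induction n rule: less_induct)
  case (less n)
  show ?case
  proof (cases "n = 1")
    case True
    then show ?thesis
      by (simp add: ramanujan_sum_eq_totient)
  next
    case False
    then obtain p where p: "prime p" "p dvd n"
      using prime_factor_nat by blast
    obtain b where b: "n = p ^ multiplicity p n * b" "\<not> p dvd b"
      using multiplicity_decompose'[of n p] less.prems prime_gt_1_nat[OF p(1)] by auto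
    define k where "k = multiplicity p n"
    have "k > 0"
      using p less.prems by (simp add: k_def prime_multiplicity_gt_zero_iff)
    then have "p ^ k > 1"
      by (rule one_less_power[OF prime_gt_1_nat[OF p(1)]])
    have n: "n = p ^ k * b"
      using b(1) by (simp add: k_def)
    with less.prems have "b > 0"
      by (auto intro: Nat.gr0I)
    with n \<open>p ^ k > 1\<close> have "b < n"
      by simp
    have cop: "coprime (p ^ k) b"
      using p(1) b(2) by (simp add: prime_imp_coprime)
    have "(\<Sum>m | m dvd n. ramanujan_sum j m) =
        (\<Sum>m | m dvd p ^ k. ramanujan_sum j m) * (\<Sum>m | m dvd b. ramanujan_sum j m)"
      unfolding n using cop \<open>b > 0\<close> prime_gt_0_nat[OF p(1)]
      by (intro divisor_sum_mult_coprime ramanujan_sum_mult_coprime) simp_all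
    also have "\<dots> = (if p ^ k dvd j \<and> b dvd j then real n else 0)"
      unfolding ramanujan_sum_divisor_sum_prime_power[OF p(1)]
        less.IH[OF \<open>b < n\<close> \<open>b > 0\<close>] by (simp add: n)
    also have "p ^ k dvd j \<and> b dvd j \<longleftrightarrow> n dvd j"
      unfolding n using cop by (auto intro: divides_mult dvd_mult_left dvd_mult_right)
    finally show ?thesis .
  qed
qed

section \<open>Eigenvalues and the complement\<close>

lemma finite_proper_divisors: "finite (proper_divisors n)"
  by (rule finite_subset[of _ "{..n}"]) (auto simp: proper_divisors_def)

lemma ICG_eigenvalue_all_proper_divisors:
  assumes "n > 0"
  shows "ICG_eigenvalue n (proper_divisors n) j = (if n dvd j then real n else 0) - 1"
proof -
  have "inj_on (\<lambda>d. n div d) (proper_divisors n)"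
    by (rule inj_on_inverseI[where g = "\<lambda>m. n div m"])
       (use assms in \<open>auto simp: proper_divisors_def\<close>)
  moreover have "(\<lambda>d. n div d) ` proper_divisors n = {m. m dvd n} - {1}"
  proof (intro equalityI subsetI)
    fix m assume "m \<in> {m. m dvd n} - {1}"
    then obtain d where "n = m * d" "m \<noteq> 1"
      by auto
    with assms have "m = n div d" "d \<in> proper_divisors n"
      by (auto simp: proper_divisors_def intro: Nat.gr0I)
    then show "m \<in> (\<lambda>d. n div d) ` proper_divisors n"
      by blast
  qed (use assms in \<open>auto simp: proper_divisors_def\<close>)
  ultimately have "ICG_eigenvalue n (proper_divisors n) j =
      (\<Sum>m\<in>{m. m dvd n} - {1}. ramanujan_sum j m)"
    unfolding ICG_eigenvalue_def by (metis (no_types, lifting) sum.reindex_cong)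
  also have "\<dots> = (\<Sum>m | m dvd n. ramanujan_sum j m) - ramanujan_sum j 1"
    using assms by (subst sum_diff1) auto
  finally show ?thesis
    using assms by (simp add: ramanujan_sum_divisor_sum ramanujan_sum_eq_totient)
qed

text \<open>
  Passing to the complement \<open>proper_divisors n - D\<close> replaces a difference of eigenvalues, whose
  maximum is sought, by a sum of nonnegative terms that is to be made small.
\<close>
lemma ICG_eigenvalue_0_minus:
  assumes D: "D \<subseteq> proper_divisors n" and j: "1 \<le> j" "j \<le> n - 1"
  shows "ICG_eigenvalue n D 0 - ICG_eigenvalue n D j =
    real n - (\<Sum>d\<in>proper_divisors n - D. real (totient (n div d)) - ramanujan_sum j (n div d))"
proof -
  let ?E = "proper_divisors n - D"
  have n: "n > 0" "\<not> n dvd j"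
    using j by (auto dest: dvd_imp_le)
  have E: "ICG_eigenvalue n ?E i =
      ICG_eigenvalue n (proper_divisors n) i - ICG_eigenvalue n D i" for i
    unfolding ICG_eigenvalue_def using finite_proper_divisors D by (rule sum_diff)
  have "ICG_eigenvalue n ?E 0 = (\<Sum>d\<in>?E. real (totient (n div d)))"
    unfolding ICG_eigenvalue_def using n(1)
    by (intro sum.cong ramanujan_sum_eq_totient)
       (auto simp: proper_divisors_def div_greater_zero_iff)
  then have "(\<Sum>d\<in>?E. real (totient (n div d)) - ramanujan_sum j (n div d)) =
      ICG_eigenvalue n ?E 0 - ICG_eigenvalue n ?E j"
    by (simp add: sum_subtractf ICG_eigenvalue_def)
  then show ?thesis
    using n by (simp add: E ICG_eigenvalue_all_proper_divisors)
qed

lemma ICG_eigenvalue_0_minus_le: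
  assumes D: "D \<subseteq> proper_divisors n" and j: "1 \<le> j" "j \<le> n - 1"
  shows "ICG_eigenvalue n D 0 - ICG_eigenvalue n D j \<le> real n"
    and ICG_eigenvalue_0_minus_eq_iff:
      "ICG_eigenvalue n D 0 - ICG_eigenvalue n D j = real n \<longleftrightarrow>
        (\<forall>d\<in>proper_divisors n - D. n div d dvd j)"
proof -
  have pos: "n div d > 0" if "d \<in> proper_divisors n - D" for d
    using that by (auto simp: proper_divisors_def div_greater_zero_iff)
  then have nonneg: "0 \<le> real (totient (n div d)) - ramanujan_sum j (n div d)"
    if "d \<in> proper_divisors n - D" for d
    using ramanujan_sum_le_totient that by simp
  have "0 \<le> (\<Sum>d\<in>proper_divisors n - D. real (totient (n div d)) - ramanujan_sum j (n div d))"
    using nonneg by (rule sum_nonneg)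
  then show "ICG_eigenvalue n D 0 - ICG_eigenvalue n D j \<le> real n"
    unfolding ICG_eigenvalue_0_minus[OF assms] by simp
  have "ICG_eigenvalue n D 0 - ICG_eigenvalue n D j = real n \<longleftrightarrow>
      (\<forall>d\<in>proper_divisors n - D. real (totient (n div d)) - ramanujan_sum j (n div d) = 0)"
    unfolding ICG_eigenvalue_0_minus[OF assms]
    by (subst sum_nonneg_eq_0_iff[symmetric]) (use nonneg finite_proper_divisors in auto)
  also have "\<dots> \<longleftrightarrow> (\<forall>d\<in>proper_divisors n - D. n div d dvd j)"
    using ramanujan_sum_eq_totient_iff[OF pos]
    by (intro ball_cong refl) (metis eq_iff_diff_eq_0)
  finally show "ICG_eigenvalue n D 0 - ICG_eigenvalue n D j = real n \<longleftrightarrow>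
      (\<forall>d\<in>proper_divisors n - D. n div d dvd j)" .
qed

section \<open>The spread\<close>

text \<open>
  For nonempty \<open>E\<close>, the least common multiple of the numbers \<open>n / d\<close> with \<open>d\<close> in \<open>E\<close>
  is \<open>n / Gcd E\<close>. It has a positive multiple below \<open>n\<close> precisely when it is smaller than \<open>n\<close> itself.
\<close>
lemma ex_common_multiple_codivisors_iff:
  assumes n: "n > 1" and E: "E \<subseteq> proper_divisors n"
  shows "(\<exists>j. 1 \<le> j \<and> j \<le> n - 1 \<and> (\<forall>d\<in>E. n div d dvd j)) \<longleftrightarrow> gcd_gt_one E"
proof
  assume "\<exists>j. 1 \<le> j \<and> j \<le> n - 1 \<and> (\<forall>d\<in>E. n div d dvd j)"
  then obtain j where j: "1 \<le> j" "j \<le> n - 1" "\<forall>d\<in>E. n div d dvd j"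
    by blast
  have "n dvd j * d" if "d \<in> E" for d
  proof -
    have "n = n div d * d"
      using that E by (auto simp: proper_divisors_def)
    then show ?thesis
      using j(3) that by (metis dvd_refl mult_dvd_mono)
  qed
  then have "n dvd Gcd ((*) j ` E)"
    by (auto intro: Gcd_greatest)
  then have "n dvd j * Gcd E"
    by (simp add: Gcd_mult)
  moreover have "\<not> n dvd j"
    using j(1,2) by (auto dest: dvd_imp_le)
  ultimately have "Gcd E \<noteq> 1"
    by auto
  moreover have "Gcd E \<noteq> 0" if "E \<noteq> {}"
    using that E by (auto simp: proper_divisors_def)
  ultimately show "gcd_gt_one E"
    by (metis gcd_gt_one_def less_one linorder_neqE_nat)
next
  assume gt: "gcd_gt_one E"
  show "\<exists>j. 1 \<le> j \<and> j \<le> n - 1 \<and> (\<forall>d\<in>E. n div d dvd j)"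
  proof (cases "E = {}")
    case True
    with n show ?thesis
      by (intro exI[of _ 1]) auto
  next
    case False
    define g where "g = Gcd E"
    have g: "g > 1"
      using gt False by (simp add: gcd_gt_one_def g_def)
    have gd: "g dvd d" "d dvd n" "d > 0" if "d \<in> E" for d
      using that E by (auto simp: g_def proper_divisors_def)
    with False have "g dvd n"
      by (meson dvd_trans ex_in_conv)
    then obtain j where nj: "n = g * j"
      by (rule dvdE)
    with n g have "1 \<le> j" "j < n"
      by (auto intro: Nat.gr0I simp: Suc_le_eq)
    moreover have "n div d dvd j" if d: "d \<in> E" for d
    proof -
      obtain a where a: "d = g * a"
        using gd(1)[OF d] by (rule dvdE)
      obtain b where b: "n = d * b"
        using gd(2)[OF d] by (rule dvdE)
      have "g * j = g * (a * b)"
        using a b nj by (simp add: mult.assoc)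
      with g have "j = a * b"
        by simp
      with b gd(3)[OF d] show ?thesis
        by simp
    qed
    ultimately show ?thesis
      by (intro exI[of _ j]) auto
  qed
qed

lemma ICG_spread_le:
  assumes n: "n > 1" and D: "D \<subseteq> proper_divisors n"
  shows "ICG_spread n D \<le> real n"
    and ICG_spread_eq_iff: "ICG_spread n D = real n \<longleftrightarrow> gcd_gt_one (proper_divisors n - D)"
proof -
  let ?f = "\<lambda>j. ICG_eigenvalue n D 0 - ICG_eigenvalue n D j"
  have eq: "{?f j | j. 1 \<le> j \<and> j \<le> n - 1} = ?f ` {1..n - 1}"
    by auto
  have fin: "finite (?f ` {1..n - 1})" and ne: "?f ` {1..n - 1} \<noteq> {}"
    using n by auto
  have le: "?f j \<le> real n" if "j \<in> {1..n - 1}" for j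
    using ICG_eigenvalue_0_minus_le[OF D] that by simp
  show bound: "ICG_spread n D \<le> real n"
    unfolding ICG_spread_def eq using fin ne le by (subst Max_le_iff) auto
  have "ICG_spread n D = real n \<longleftrightarrow> real n \<in> ?f ` {1..n - 1}"
    unfolding ICG_spread_def eq Max_eq_iff[OF fin ne] using le by blast
  also have "\<dots> \<longleftrightarrow> (\<exists>j\<in>{1..n - 1}. ?f j = real n)"
    unfolding image_iff by metis
  also have "\<dots> \<longleftrightarrow> (\<exists>j. 1 \<le> j \<and> j \<le> n - 1 \<and> (\<forall>d\<in>proper_divisors n - D. n div d dvd j))"
    using ICG_eigenvalue_0_minus_eq_iff[OF D] by auto
  also have "\<dots> \<longleftrightarrow> gcd_gt_one (proper_divisors n - D)"
    using n by (intro ex_common_multiple_codivisors_iff) auto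
  finally show "ICG_spread n D = real n \<longleftrightarrow> gcd_gt_one (proper_divisors n - D)" .
qed

lemma maxspread_eq:
  assumes n: "n > 1"
  shows "maxspread n = real n"
proof -
  have eq: "{ICG_spread n D | D. D \<subseteq> proper_divisors n} =
      ICG_spread n ` Pow (proper_divisors n)"
    by auto
  have "ICG_spread n (proper_divisors n) = real n"
    using ICG_spread_eq_iff[OF n order.refl] by (simp add: gcd_gt_one_def)
  then have "real n \<in> ICG_spread n ` Pow (proper_divisors n)"
    by (metis Pow_top image_eqI)
  moreover have "x \<le> real n" if "x \<in> ICG_spread n ` Pow (proper_divisors n)" for x
    using that ICG_spread_le[OF n] by auto
  ultimately show ?thesis
    unfolding maxspread_def eq using finite_proper_divisors by (intro Max_eqI) auto
qed

theorem theorem3: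
  fixes n :: nat
  assumes "n > 1"
  shows "maxspread n = real n \<and>
    (\<forall>D. D \<subseteq> proper_divisors n \<longrightarrow> Digraph_Component.connected (with_proj (ICG n D)) \<longrightarrow>
      (ICG_spread n D = maxspread n \<longleftrightarrow> gcd_gt_one (proper_divisors n - D)))"
  using maxspread_eq[OF assms] ICG_spread_eq_iff[OF assms] by simp

end
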